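(* Let $L$ be a signed alphabet. Let $w\in\mathcal{M}(L)$ be a word, let $\lambda=(\lambda_1,\ldots,\lambda_r)$ be the shape of the tableau $T(w)$, and let $\tilde\lambda=(\tilde\lambda_1,\ldots,\tilde\lambda_s)$ be the conjugate partition of $\lambda$. For any integer $k\ge 1$ we have $$l_k(w)=\lambda_1+\cdots+\lambda_k,\qquad \tilde l_k(w)=\tilde\lambda_1+\cdots+\tilde\lambda_k.$$
   Context: A signed alphabet is a finite or countable totally ordered set $L$ together with an arbitrary map $|\cdot|:L\to\mathbb{Z}_2=\{0,1\}$. No relation between the order and the map $|\cdot|$ is assumed. For a partition $\lambda=(\lambda_1\ge\dots\ge\lambda_m>0)$, let $D(\lambda)=\{(i,j): 1\le i\le m,\ 1\le j\le\lambda_i\}$; the conjugate partition $\tilde\lambda$ is the partition whose parts are the column lengths of $D(\lambda)$. Parts of a partition beyond its number of parts are taken to be $0$. A super semistandard Young tableau over $L$ of shape $\lambda$ is a pair $T=(\lambda,\tau)$ with $\tau:D(\lambda)\to L$ such that, whenever the boxes involved lie in $D(\lambda)$: (i) $\tau(i,j)\le\tau(i,j+1)$, with $\tau(i,j)=\tau(i,j+1)$ only if $|\tau(i,j)|=0$; (ii) $\tau(i,j)\le\tau(i+1,j)$, with $\tau(i,j)=\tau(i+1,j)$ only if $|\tau(i,j)|=1$. The empty tableau $\varnothing$ is admitted. Row-insertion: for a tableau $T$ and $x\in L$, $[T\leftarrow x]$ is the tableau obtained as follows. Start with $i=1$. If row $i$ contains an entry $y$ with $x<y$ (in case $|x|=0$),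 respectively $x\le y$ (in case $|x|=1$), replace the leftmost such entry $y$ by $x$, then set $x:=y$, $i:=i+1$ and repeat. Otherwise append $x$ at the end of row $i$ (possibly a new row) and stop. $\mathcal{M}(L)$ is the free monoid of all words in letters of $L$ (including the empty word). For $w=x_1\cdots x_n$, $T(w):=[[[\varnothing\leftarrow x_1]\leftarrow x_2]\cdots\leftarrow x_n]$. A row word is a word $x_1\cdots x_n$ with $x_i\le x_{i+1}$ for all $i$, and $x_i=x_{i+1}$ only if $|x_i|=0$. A column word is a word $x_1\cdots x_n$ with $x_i\ge x_{i+1}$ for all $i$, and $x_i=x_{i+1}$ only if $|x_i|=1$ (i.e. the bottom-to-top reading of a one-column tableau). The empty word is both. A word $v$ is extracted by $w=x_1\cdots x_n$ if $v=x_{i_1}\cdots x_{i_m}$ with $1\le i_1<\cdots<i_m\le n$; extracted words are disjoint if the sets of positions they use are pairwise disjoint. $l_k(w)$ is the maximal value of the sum of the lengths of $k$ disjoint row words extracted by $w$; $\tilde l_k(w)$ is the maximal value of the sum of the lengths of $k$ disjoint column words extracted by $w$. *)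

theory Defs
  imports "HOL-Library.Z2" "HOL-Library.Countable_Set" "HOL-Library.Disjoint_Sets"
begin

text \<open>
  A signed alphabet is given by a countable set \<open>L\<close> of elements of a linearly ordered type,
  with the order induced from the type, and a sign map \<open>sg\<close> into \<open>bit\<close> (the integers modulo 2).
  Values of \<open>sg\<close> outside \<open>L\<close> play no role.
\<close>

section \<open>Partitions\<close>

definition is_partition :: "nat list \<Rightarrow> bool" where
  "is_partition lam \<longleftrightarrow> sorted_wrt (\<ge>) lam \<and> (\<forall>p\<in>set lam. 0 < p)"

text \<open>Parts are numbered from 1, and are 0 beyond the number of parts.\<close>

definition part :: "nat list \<Rightarrow> nat \<Rightarrow> nat" where
  "part lam i = (if 1 \<le> i \<and> i \<le> length lam then lam ! (i - 1) else 0)"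

definition diagram :: "nat list \<Rightarrow> (nat \<times> nat) set" where
  "diagram lam = {(i, j). 1 \<le> i \<and> i \<le> length lam \<and> 1 \<le> j \<and> j \<le> part lam i}"

text \<open>The diagram of a partition has \<open>part lam 1\<close> columns.\<close>

definition conjugate :: "nat list \<Rightarrow> nat list" where
  "conjugate lam = map (\<lambda>j. card {i. (i, j) \<in> diagram lam}) [1..<Suc (part lam 1)]"

section \<open>Tableaux\<close>

text \<open>
  A tableau is represented by the list of its rows, from top to bottom; its shape is the list of
  row lengths, and the box \<open>(i, j)\<close>, numbered from 1, contains \<open>entry T i j\<close>.
\<close>

definition shape :: "'a list list \<Rightarrow> nat list" where
  "shape T = map length T"

definition entry :: "'a list list \<Rightarrow> nat \<Rightarrow> nat \<Rightarrow> 'a" where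
  "entry T i j = T ! (i - 1) ! (j - 1)"

definition super_ssyt :: "'a::linorder set \<Rightarrow> ('a \<Rightarrow> bit) \<Rightarrow> 'a list list \<Rightarrow> bool" where
  "super_ssyt L sg T \<longleftrightarrow>
     is_partition (shape T) \<and>
     (\<forall>(i, j)\<in>diagram (shape T). entry T i j \<in> L) \<and>
     (\<forall>i j. (i, j) \<in> diagram (shape T) \<and> (i, j + 1) \<in> diagram (shape T) \<longrightarrow>
        entry T i j \<le> entry T i (j + 1) \<and>
        (entry T i j = entry T i (j + 1) \<longrightarrow> sg (entry T i j) = 0)) \<and>
     (\<forall>i j. (i, j) \<in> diagram (shape T) \<and> (i + 1, j) \<in> diagram (shape T) \<longrightarrow>
        entry T i j \<le> entry T (i + 1) j \<and>
        (entry T i j = entry T (i + 1) j \<longrightarrow> sg (entry T i j) = 1))"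

section \<open>Row insertion\<close>

definition bumps :: "('a::linorder \<Rightarrow> bit) \<Rightarrow> 'a \<Rightarrow> 'a \<Rightarrow> bool" where
  "bumps sg x y \<longleftrightarrow> (if sg x = 0 then x < y else x \<le> y)"

text \<open>
  Insertion into a single row returns the new row together with the entry that was replaced,
  or \<open>None\<close> if the letter was appended at the end.
\<close>

fun insert_row :: "('a::linorder \<Rightarrow> bit) \<Rightarrow> 'a list \<Rightarrow> 'a \<Rightarrow> 'a list \<times> 'a option" where
  "insert_row sg [] x = ([x], None)"
| "insert_row sg (y # ys) x =
     (if bumps sg x y then (x # ys, Some y)
      else (case insert_row sg ys x of (zs, b) \<Rightarrow> (y # zs, b)))"

fun row_insertion :: "('a::linorder \<Rightarrow> bit) \<Rightarrow> 'a list list \<Rightarrow> 'a \<Rightarrow> 'a list list" where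
  "row_insertion sg [] x = [[x]]"
| "row_insertion sg (r # rs) x =
     (case insert_row sg r x of
        (r', None) \<Rightarrow> r' # rs
      | (r', Some y) \<Rightarrow> r' # row_insertion sg rs y)"

definition tableau_of :: "('a::linorder \<Rightarrow> bit) \<Rightarrow> 'a list \<Rightarrow> 'a list list" where
  "tableau_of sg w = foldl (row_insertion sg) [] w"

section \<open>Row words, column words and extracted words\<close>

definition row_word :: "('a::linorder \<Rightarrow> bit) \<Rightarrow> 'a list \<Rightarrow> bool" where
  "row_word sg w \<longleftrightarrow> (\<forall>i. Suc i < length w \<longrightarrow>
     w ! i \<le> w ! Suc i \<and> (w ! i = w ! Suc i \<longrightarrow> sg (w ! i) = 0))"

definition column_word :: "('a::linorder \<Rightarrow> bit) \<Rightarrow> 'a list \<Rightarrow> bool" where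
  "column_word sg w \<longleftrightarrow> (\<forall>i. Suc i < length w \<longrightarrow>
     w ! i \<ge> w ! Suc i \<and> (w ! i = w ! Suc i \<longrightarrow> sg (w ! i) = 1))"

text \<open>
  The word extracted by \<open>w\<close> at a set \<open>I\<close> of positions is \<open>nths w I\<close>.  The extracted words may be
  empty, so that \<open>k\<close> disjoint words exist in every \<open>w\<close>.
\<close>

definition disjoint_extractions ::
    "('a list \<Rightarrow> bool) \<Rightarrow> nat \<Rightarrow> 'a list \<Rightarrow> (nat \<Rightarrow> nat set) \<Rightarrow> bool" where
  "disjoint_extractions P k w I \<longleftrightarrow>
     (\<forall>j<k. I j \<subseteq> {..<length w} \<and> P (nths w (I j))) \<and> disjoint_family_on I {..<k}"

definition max_row_length :: "('a::linorder \<Rightarrow> bit) \<Rightarrow> nat \<Rightarrow> 'a list \<Rightarrow> nat" where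
  "max_row_length sg k w =
     Max {(\<Sum>j<k. length (nths w (I j))) | I. disjoint_extractions (row_word sg) k w I}"

definition max_column_length :: "('a::linorder \<Rightarrow> bit) \<Rightarrow> nat \<Rightarrow> 'a list \<Rightarrow> nat" where
  "max_column_length sg k w =
     Max {(\<Sum>j<k. length (nths w (I j))) | I. disjoint_extractions (column_word sg) k w I}"

section \<open>Well-definedness\<close>

text \<open>The sets whose maxima are taken are finite and nonempty.\<close>

lemma disjoint_extractions_length_le:
  assumes "disjoint_extractions P k w I"
  shows "(\<Sum>j<k. length (nths w (I j))) \<le> length w"
proof -
  have "(\<Sum>j<k. length (nths w (I j))) = (\<Sum>j<k. card (I j))"
  proof (rule sum.cong)
    fix j assume "j \<in> {..<k}"
    then have "I j \<subseteq> {..<length w}"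
      using assms by (auto simp: disjoint_extractions_def)
    then have "{i. i < length w \<and> i \<in> I j} = I j" by auto
    then show "length (nths w (I j)) = card (I j)" by (simp add: length_nths)
  qed simp
  also have "\<dots> = card (\<Union>j<k. I j)"
  proof (rule card_UN_disjoint[symmetric])
    show "\<forall>j\<in>{..<k}. finite (I j)"
      using assms by (auto simp: disjoint_extractions_def intro: finite_subset)
    show "\<forall>i\<in>{..<k}. \<forall>j\<in>{..<k}. i \<noteq> j \<longrightarrow> I i \<inter> I j = {}"
      using assms by (auto simp: disjoint_extractions_def disjoint_family_on_def)
  qed simp
  also have "\<dots> \<le> card {..<length w}"
    using assms by (intro card_mono) (auto simp: disjoint_extractions_def)
  finally show ?thesis by simp
qed

lemma finite_extraction_lengths:
  "finite {(\<Sum>j<k. length (nths w (I j))) | I. disjoint_extractions P k w I}"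
  by (rule finite_subset[of _ "{..length w}"]) (auto dest: disjoint_extractions_length_le)

lemma disjoint_extractions_empty:
  "P [] \<Longrightarrow> disjoint_extractions P k w (\<lambda>_. {})"
  by (simp add: disjoint_extractions_def disjoint_family_on_def)

lemma row_word_Nil: "row_word sg []" and column_word_Nil: "column_word sg []"
  by (simp_all add: row_word_def column_word_def)

text \<open>Row insertion produces tableaux.\<close>

definition col_lt :: "('a::linorder \<Rightarrow> bit) \<Rightarrow> 'a list \<Rightarrow> 'a list \<Rightarrow> bool" where
  "col_lt sg r s \<longleftrightarrow> length s \<le> length r \<and> (\<forall>j<length s. bumps sg (r ! j) (s ! j))"

fun tab_rows :: "'a::linorder set \<Rightarrow> ('a \<Rightarrow> bit) \<Rightarrow> 'a list list \<Rightarrow> bool" where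
  "tab_rows L sg [] \<longleftrightarrow> True"
| "tab_rows L sg (r # rs) \<longleftrightarrow> r \<noteq> [] \<and> set r \<subseteq> L \<and> row_word sg r \<and>
     (rs \<noteq> [] \<longrightarrow> col_lt sg r (hd rs)) \<and> tab_rows L sg rs"

lemma bumps_iff: "bumps sg x y \<longleftrightarrow> x \<le> y \<and> (x = y \<longrightarrow> sg x = 1)"
  by (cases "sg x = 0") (auto simp: bumps_def order_le_less)

lemma not_bumps_iff: "\<not> bumps sg y x \<longleftrightarrow> x \<le> y \<and> (x = y \<longrightarrow> sg x = 0)"
  by (cases "sg y = 0") (auto simp: bumps_def order_le_less)

lemma row_word_bumps: "row_word sg w \<longleftrightarrow> (\<forall>i. Suc i < length w \<longrightarrow> \<not> bumps sg (w ! Suc i) (w ! i))"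
  by (simp add: row_word_def not_bumps_iff)

lemma bumps_trans: "bumps sg x y \<Longrightarrow> bumps sg y z \<Longrightarrow> bumps sg x z"
  by (auto simp: bumps_iff)

lemma not_bumps_trans: "\<not> bumps sg y x \<Longrightarrow> \<not> bumps sg z y \<Longrightarrow> \<not> bumps sg z x"
  by (auto simp: not_bumps_iff)

lemma row_word_mono:
  assumes "row_word sg w" "i < j" "j < length w"
  shows "\<not> bumps sg (w ! j) (w ! i)"
  using assms(2,3)
proof (induction j rule: less_induct)
  case (less j)
  then obtain m where m: "j = Suc m" by (cases j) auto
  have s: "\<not> bumps sg (w ! j) (w ! m)"
    using assms(1) less.prems m by (auto simp: row_word_bumps)
  show ?case
  proof (cases "m = i")
    case False
    then have "\<not> bumps sg (w ! m) (w ! i)" using less m by auto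
    with s show ?thesis by (blast dest: not_bumps_trans)
  qed (use s in simp)
qed

lemma insert_row_cases:
  obtains (append) "insert_row sg r x = (r @ [x], None)" "\<forall>j<length r. \<not> bumps sg x (r ! j)"
  | (bump) p where "p < length r" "insert_row sg r x = (r[p := x], Some (r ! p))"
      "bumps sg x (r ! p)" "\<forall>j<p. \<not> bumps sg x (r ! j)"
proof -
  have "(insert_row sg r x = (r @ [x], None) \<and> (\<forall>j<length r. \<not> bumps sg x (r ! j))) \<or>
    (\<exists>p<length r. insert_row sg r x = (r[p := x], Some (r ! p)) \<and>
      bumps sg x (r ! p) \<and> (\<forall>j<p. \<not> bumps sg x (r ! j)))"
  proof (induction r)
    case (Cons y ys)
    show ?case
    proof (cases "bumps sg x y")
      case True
      then show ?thesis by (intro disjI2 exI[of _ 0]) auto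
    next
      case False
      from Cons show ?thesis
      proof (elim disjE exE conjE)
        fix p assume "p < length ys" "insert_row sg ys x = (ys[p := x], Some (ys ! p))"
          "bumps sg x (ys ! p)" "\<forall>j<p. \<not> bumps sg x (ys ! j)"
        then show ?thesis using False
          by (intro disjI2 exI[of _ "Suc p"]) (auto simp: less_Suc_eq_0_disj)
      qed (use False in \<open>auto simp: less_Suc_eq_0_disj\<close>)
    qed
  qed simp
  then show thesis using append bump by blast
qed

lemma insert_row_set:
  assumes "insert_row sg r x = (r', b)" "set r \<subseteq> L" "x \<in> L"
  shows "set r' \<subseteq> L" "\<And>y. b = Some y \<Longrightarrow> y \<in> L"
proof -
  have "set r' \<subseteq> L \<and> (\<forall>y. b = Some y \<longrightarrow> y \<in> L)"
  proof (cases rule: insert_row_cases[of sg r x])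
    case append
    then show ?thesis using assms by auto
  next
    case (bump p)
    have "set (r[p := x]) \<subseteq> L"
      using set_update_subset_insert[of r p x] assms(2,3) by blast
    moreover have "r ! p \<in> L" using bump(1) assms(2) by auto
    ultimately show ?thesis using bump(2) assms(1) by auto
  qed
  then show "set r' \<subseteq> L" "\<And>y. b = Some y \<Longrightarrow> y \<in> L" by auto
qed

lemma insert_row_row_word:
  assumes "row_word sg r"
  shows "row_word sg (fst (insert_row sg r x))"
proof (cases rule: insert_row_cases[of sg r x])
  case append
  then show ?thesis using assms
    by (auto simp: row_word_bumps nth_append less_Suc_eq)
next
  case (bump p)
  show ?thesis unfolding bump(2) row_word_bumps fst_conv
  proof (intro allI impI)
    fix i assume i: "Suc i < length (r[p := x])"
    then have o: "\<not> bumps sg (r ! Suc i) (r ! i)" using assms by (auto simp: row_word_bumps)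
    consider "i = p" | "Suc i = p" | "i \<noteq> p" "Suc i \<noteq> p" by blast
    then show "\<not> bumps sg (r[p := x] ! Suc i) (r[p := x] ! i)"
    proof cases
      case 1
      then show ?thesis using o i bump
        by (auto simp: bumps_iff)
    next
      case 2
      then show ?thesis using bump by auto
    next
      case 3
      then show ?thesis using o by simp
    qed
  qed
qed

lemma col_lt_bump:
  assumes "row_word sg r" "col_lt sg r s"
    and "insert_row sg r x = (r', Some y)"
  shows "col_lt sg r' (fst (insert_row sg s y))"
proof (cases rule: insert_row_cases[of sg r x])
  case append
  then show ?thesis using assms by simp
next
  case (bump p)
  then have r': "r' = r[p := x]" and y: "y = r ! p" using assms by auto
  have len: "length s \<le> length r" and c: "\<And>j. j < length s \<Longrightarrow> bumps sg (r ! j) (s ! j)"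
    using assms(2) by (auto simp: col_lt_def)
  have old: "bumps sg (r' ! j) (s ! j)" if "j < length s" for j
    using c[OF that] bump(1,3) unfolding r'
    by (cases "j = p") (auto intro: bumps_trans)
  have new: "bumps sg (r' ! q) y" if "q \<le> p" for q
  proof (cases "q = p")
    case True
    then show ?thesis using bump r' y by simp
  next
    case False
    then have q: "q < p" using that by simp
    then have "\<not> bumps sg y (r ! q)" using row_word_mono[OF assms(1) q bump(1)] y by simp
    moreover have "r ! q \<noteq> y" using bump q y by auto
    ultimately show ?thesis using q r' by (auto simp: bumps_iff)
  qed
  show ?thesis
  proof (cases rule: insert_row_cases[of sg s y])
    case append
    have "length s \<le> p"
      using append(2) c[of p] y by (meson not_le)
    then show ?thesis using append old new len bump(1) r'
      by (auto simp: col_lt_def nth_append less_Suc_eq)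
  next
    case b: (bump q)
    have "q \<le> p"
      using b(1,4) c[of p] y by (meson not_le less_trans)
    then show ?thesis using b old new len r'
      by (auto simp: col_lt_def nth_list_update)
  qed
qed

lemma col_lt_append:
  "col_lt sg r s \<Longrightarrow> col_lt sg (r @ t) s"
  by (auto simp: col_lt_def nth_append)

lemma tab_rows_row_insertion:
  "tab_rows L sg T \<Longrightarrow> x \<in> L \<Longrightarrow> tab_rows L sg (row_insertion sg T x)"
proof (induction T arbitrary: x)
  case Nil
  then show ?case by (simp add: row_word_def)
next
  case (Cons r rs)
  obtain r' b where ir: "insert_row sg r x = (r', b)" by fastforce
  have r: "r \<noteq> []" "set r \<subseteq> L" "row_word sg r" and rs: "tab_rows L sg rs"
    and c: "rs \<noteq> [] \<Longrightarrow> col_lt sg r (hd rs)"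
    using Cons.prems by auto
  have r': "set r' \<subseteq> L" "row_word sg r'" "r' \<noteq> []"
    using insert_row_set(1)[OF ir r(2) Cons.prems(2)] insert_row_row_word[OF r(3), of x] ir r(1)
    by (simp_all, cases rule: insert_row_cases[of sg r x]) auto
  show ?case
  proof (cases b)
    case None
    then have "r' = r @ [x]" using ir by (cases rule: insert_row_cases[of sg r x]) auto
    then show ?thesis using ir None r' rs c by (auto intro: col_lt_append)
  next
    case (Some y)
    have y: "y \<in> L" using insert_row_set(2)[OF ir r(2) Cons.prems(2)] Some by simp
    have "col_lt sg r (case rs of [] \<Rightarrow> [] | s # _ \<Rightarrow> s)"
      using c by (cases rs) (auto simp: col_lt_def)
    then have "col_lt sg r' (fst (insert_row sg (case rs of [] \<Rightarrow> [] | s # _ \<Rightarrow> s) y))"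
      using col_lt_bump[OF r(3)] ir Some by blast
    then have "col_lt sg r' (hd (row_insertion sg rs y))"
      by (cases rs) (auto split: prod.splits option.splits)
    then show ?thesis using ir Some r' Cons.IH[OF rs y] by simp
  qed
qed

lemma tab_rows_nth:
  assumes "tab_rows L sg T" "i < length T"
  shows "T ! i \<noteq> []" "set (T ! i) \<subseteq> L" "row_word sg (T ! i)"
    "Suc i < length T \<Longrightarrow> col_lt sg (T ! i) (T ! Suc i)"
  using assms
proof (induction T arbitrary: i)
  case (Cons r rs)
  { case 1 then show ?case using Cons by (cases i) auto }
  { case 2 then show ?case using Cons by (cases i) auto }
  { case 3 then show ?case using Cons by (cases i) auto }
  { case 4 then show ?case using Cons by (cases i) (auto simp: hd_conv_nth) }
qed simp_all

lemma tab_rows_sorted: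
  "tab_rows L sg T \<Longrightarrow> sorted_wrt (\<ge>) (map length T)"
proof (induction T)
  case (Cons r rs)
  then show ?case by (cases rs) (auto simp: col_lt_def)
qed simp

lemma tab_rows_super_ssyt:
  assumes "tab_rows L sg T"
  shows "super_ssyt L sg T"
  unfolding super_ssyt_def
proof (intro conjI)
  show "is_partition (shape T)"
    using tab_rows_sorted[OF assms] tab_rows_nth(1)[OF assms]
    by (auto simp: is_partition_def shape_def in_set_conv_nth)
  have d: "\<exists>a b. i = Suc a \<and> j = Suc b \<and> a < length T \<and> b < length (T ! a)"
    if "(i, j) \<in> diagram (shape T)" for i j
    using that by (cases i; cases j) (auto simp: diagram_def part_def shape_def)
  show "\<forall>(i, j)\<in>diagram (shape T). entry T i j \<in> L"
    using tab_rows_nth(2)[OF assms] by (fastforce simp: entry_def dest!: d)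
  show "\<forall>i j. (i, j) \<in> diagram (shape T) \<and> (i, j + 1) \<in> diagram (shape T) \<longrightarrow>
        entry T i j \<le> entry T i (j + 1) \<and>
        (entry T i j = entry T i (j + 1) \<longrightarrow> sg (entry T i j) = 0)"
    using tab_rows_nth(3)[OF assms] by (fastforce simp: entry_def row_word_def dest!: d)
  show "\<forall>i j. (i, j) \<in> diagram (shape T) \<and> (i + 1, j) \<in> diagram (shape T) \<longrightarrow>
        entry T i j \<le> entry T (i + 1) j \<and>
        (entry T i j = entry T (i + 1) j \<longrightarrow> sg (entry T i j) = 1)"
    using tab_rows_nth(4)[OF assms] by (fastforce simp: entry_def col_lt_def bumps_iff dest!: d)
qed

theorem super_ssyt_tableau_of:
  assumes "w \<in> lists L"
  shows "super_ssyt L sg (tableau_of sg w)"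
proof -
  have "tab_rows L sg (foldl (row_insertion sg) T w)" if "tab_rows L sg T" for T
    using assms that
    by (induction w arbitrary: T) (auto intro: tab_rows_row_insertion)
  then show ?thesis by (simp add: tableau_of_def tab_rows_super_ssyt)
qed

end

theory Submission
  imports Defs
begin

text \<open>
  For letters write \<open>P a b\<close> if \<open>b\<close> may follow \<open>a\<close> in a row word, that is, if \<open>b\<close> does not bump
  \<open>a\<close>. Then \<open>b\<close> may follow \<open>a\<close> in a column word exactly when \<open>P a b\<close> fails, and both \<open>P\<close> and
  its negation are transitive. Nothing else about the order and the signs is needed, so every
  statement about rows becomes one about columns on replacing \<open>P\<close> by its negation.

  The proof compares \<open>w\<close> with the reading word of its tableau, rows taken from bottom to top.
  Row insertion of a letter is a sequence of Knuth relations on reading words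
  (\<open>knuth_steps_row_insertion\<close>), so the two words are connected by Knuth relations
  (\<open>knuth_steps_tableau_of\<close>). A Knuth relation does not change the possible total lengths of \<open>k\<close>
  disjoint row words: only two adjacent letters are interchanged, and if one row word uses both,
  then the third letter of the relation allows that row word to be repaired, where necessary by
  exchanging tails with a second one (\<open>chain_sums_swap_last\<close>). The two kinds of Knuth relation
  are mirror images of each other, and each kind is preserved when \<open>P\<close> is negated; hence one
  computation covers both relations, for rows and for columns.

  In the reading word of a tableau the rows are row words and the columns are column words. The
  first \<open>k\<close> rows attain the claimed value. Conversely, a row word and a column word share at most
  one position, so \<open>k\<close> disjoint row words cover at most \<open>min k c\<close> positions of a column of length
  \<open>c\<close>; these bounds add up to the number of cells in the first \<open>k\<close> rows
  (\<open>chain_sums_tableau_word_upper\<close>). Columns are treated by transposing the diagram.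
\<close>

section \<open>Families of disjoint chains as colourings\<close>

text \<open>A relation that is transitive together with its negation.\<close>

definition bitransitive :: "('a \<Rightarrow> 'a \<Rightarrow> bool) \<Rightarrow> bool" where
  "bitransitive P \<longleftrightarrow> transp P \<and> transp (\<lambda>a b. \<not> P a b)"

text \<open>
  A family of \<open>k\<close> disjoint extracted words is encoded by colouring the letters of the word: colour
  \<open>j < k\<close> marks the letters of the \<open>j\<close>-th extracted word, colours from \<open>k\<close> on mark unused letters.
  The colouring is admissible if the letters of each colour below \<open>k\<close> form a \<open>P\<close>-chain, read from
  left to right.
\<close>

definition chain_colouring :: "('a \<Rightarrow> 'a \<Rightarrow> bool) \<Rightarrow> nat \<Rightarrow> ('a \<times> nat) list \<Rightarrow> bool" where
  "chain_colouring P k = sorted_wrt (\<lambda>(a, i) (b, j). i = j \<and> i < k \<longrightarrow> P a b)"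

text \<open>The number of used letters, which is the sum of the lengths of the extracted words.\<close>

definition coloured_size :: "nat \<Rightarrow> ('a \<times> nat) list \<Rightarrow> nat" where
  "coloured_size k zs = length (filter (\<lambda>z. snd z < k) zs)"

text \<open>All total lengths of \<open>k\<close> disjoint \<open>P\<close>-chains extracted by \<open>w\<close>.\<close>

definition chain_sums :: "('a \<Rightarrow> 'a \<Rightarrow> bool) \<Rightarrow> nat \<Rightarrow> 'a list \<Rightarrow> nat set" where
  "chain_sums P k w = {coloured_size k zs | zs. map fst zs = w \<and> chain_colouring P k zs}"

lemma bitransitive_not: "bitransitive P \<Longrightarrow> bitransitive (\<lambda>a b. \<not> P a b)"
  by (simp add: bitransitive_def)

lemma bitransitive_conversep: "bitransitive P \<Longrightarrow> bitransitive (\<lambda>a b. P b a)"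
  unfolding bitransitive_def transp_def by blast

lemma bitransitiveD:
  assumes "bitransitive P"
  shows "P a b \<Longrightarrow> P b c \<Longrightarrow> P a c" "P a c \<Longrightarrow> P a b \<or> P b c"
  using assms unfolding bitransitive_def transp_def by blast+

lemma sorted_wrt_nths_iff:
  "sorted_wrt P (nths w A) \<longleftrightarrow>
     (\<forall>q<length w. \<forall>p<q. p \<in> A \<and> q \<in> A \<longrightarrow> P (w ! p) (w ! q))"
proof (induction w arbitrary: A)
  case (Cons x w)
  show ?case
    by (auto simp: nths_Cons Cons.IH set_nths All_less_Suc2)
qed simp

lemma chain_colouring_iff:
  "chain_colouring P k zs \<longleftrightarrow> (\<forall>q<length zs. \<forall>p<q.
     snd (zs ! p) = snd (zs ! q) \<and> snd (zs ! p) < k \<longrightarrow> P (fst (zs ! p)) (fst (zs ! q)))"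
  unfolding chain_colouring_def sorted_wrt_iff_nth_less case_prod_beta by blast

lemma coloured_size_card: "coloured_size k zs = card {p. p < length zs \<and> snd (zs ! p) < k}"
  by (simp add: coloured_size_def length_filter_conv_card)

lemma extraction_sum_card:
  assumes "disjoint_extractions W k w I"
  shows "(\<Sum>j<k. length (nths w (I j))) = card (\<Union>j<k. I j)"
proof -
  have sub: "I j \<subseteq> {..<length w}" if "j < k" for j
    using assms that by (auto simp: disjoint_extractions_def)
  have "length (nths w (I j)) = card (I j)" if "j < k" for j
  proof -
    have "{i. i < length w \<and> i \<in> I j} = I j" using sub[OF that] by auto
    then show ?thesis by (simp add: length_nths)
  qed
  then have "(\<Sum>j<k. length (nths w (I j))) = (\<Sum>j<k. card (I j))" by simp
  also have "\<dots> = card (\<Union>j<k. I j)"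
    using sub assms
    by (intro card_UN_disjoint[symmetric])
      (auto simp: disjoint_extractions_def disjoint_family_on_def intro: finite_subset)
  finally show ?thesis .
qed

lemma extraction_sums_eq_chain_sums:
  assumes W: "\<And>v. W v \<longleftrightarrow> sorted_wrt P v"
  shows "{(\<Sum>j<k. length (nths w (I j))) | I. disjoint_extractions W k w I} = chain_sums P k w"
proof (intro equalityI subsetI)
  fix n assume "n \<in> {(\<Sum>j<k. length (nths w (I j))) | I. disjoint_extractions W k w I}"
  then obtain I where I: "disjoint_extractions W k w I"
    and n: "n = card (\<Union>j<k. I j)"
    using extraction_sum_card by fastforce
  have sub: "I j \<subseteq> {..<length w}" and chain: "sorted_wrt P (nths w (I j))" if "j < k" for j
    using I that by (auto simp: disjoint_extractions_def W)
  \<comment> \<open>Unused positions get the colour \<open>k\<close>.\<close>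
  define c where "c p = (if \<exists>j<k. p \<in> I j then SOME j. j < k \<and> p \<in> I j else k)" for p
  have c_some: "c p < k \<and> p \<in> I (c p)" if "\<exists>j<k. p \<in> I j" for p
    using someI_ex[OF that] that by (simp add: c_def)
  have c_less: "c p < k \<longleftrightarrow> (\<exists>j<k. p \<in> I j)" for p
    using c_some[of p] by (cases "\<exists>j<k. p \<in> I j") (auto simp: c_def)
  have c_in: "p \<in> I (c p)" if "c p < k" for p
    using c_some c_less that by blast
  define zs where "zs = zip w (map c [0..<length w])"
  have zs: "length zs = length w" "\<And>p. p < length w \<Longrightarrow> zs ! p = (w ! p, c p)" "map fst zs = w"
    by (simp_all add: zs_def)
  have "P (w ! p) (w ! q)" if "q < length w" "p < q" "c p = c q" "c p < k" for p q
    using chain[OF that(4)] c_in[of p] c_in[of q] that by (simp add: sorted_wrt_nths_iff)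
  then have "chain_colouring P k zs"
    by (simp add: chain_colouring_iff zs)
  moreover have "{p. p < length zs \<and> snd (zs ! p) < k} = (\<Union>j<k. I j)"
  proof (intro set_eqI iffI)
    fix p assume "p \<in> (\<Union>j<k. I j)"
    then obtain j where j: "j < k" "p \<in> I j" by blast
    then show "p \<in> {p. p < length zs \<and> snd (zs ! p) < k}"
      using sub[OF j(1)] c_less[of p] by (auto simp: zs(1,2))
  qed (auto simp: zs(1,2) c_less)
  ultimately show "n \<in> chain_sums P k w"
    unfolding chain_sums_def using zs(3) n coloured_size_card[of k zs] by auto
next
  fix n assume "n \<in> chain_sums P k w"
  then obtain zs where zs: "map fst zs = w" "chain_colouring P k zs" "n = coloured_size k zs"
    by (auto simp: chain_sums_def)
  define I where "I j = {p. p < length w \<and> snd (zs ! p) = j}" for j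
  have len: "length zs = length w" using zs(1) by auto
  have "disjoint_extractions W k w I"
    using zs(1,2) unfolding chain_colouring_iff
    by (auto simp: disjoint_extractions_def disjoint_family_on_def I_def W sorted_wrt_nths_iff)
  moreover have "(\<Union>j<k. I j) = {p. p < length zs \<and> snd (zs ! p) < k}"
    by (auto simp: I_def len)
  ultimately show "n \<in> {(\<Sum>j<k. length (nths w (I j))) | I. disjoint_extractions W k w I}"
    using extraction_sum_card[of W k w I] zs(3) coloured_size_card[of k zs] by auto
qed

lemma chain_sums_rev: "chain_sums P k (rev w) = chain_sums (\<lambda>a b. P b a) k w"
proof -
  have sub: "chain_sums P k (rev w) \<subseteq> chain_sums (\<lambda>a b. P b a) k w" for P and w :: "'a list"
  proof
    fix n assume "n \<in> chain_sums P k (rev w)"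
    then obtain zs where zs: "map fst zs = rev w" "chain_colouring P k zs" "n = coloured_size k zs"
      by (auto simp: chain_sums_def)
    have "chain_colouring (\<lambda>a b. P b a) k (rev zs)"
      using zs(2) by (auto simp: chain_colouring_def sorted_wrt_rev elim!: sorted_wrt_mono_rel[rotated])
    moreover have "map fst (rev zs) = w" using zs(1) by (simp add: rev_map[symmetric])
    moreover have "n = coloured_size k (rev zs)"
      using zs(3) by (simp add: coloured_size_def rev_filter[symmetric])
    ultimately show "n \<in> chain_sums (\<lambda>a b. P b a) k w" by (auto simp: chain_sums_def)
  qed
  show ?thesis using sub[of P w] sub[of "\<lambda>a b. P b a" "rev w"] by auto
qed

section \<open>Knuth relations\<close>

text \<open>
  The hypotheses imply \<open>P x z\<close> and \<open>\<not> P z x\<close>, so the only chains affected by the interchange of \<open>x\<close>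
  and \<open>z\<close> are those of \<open>y x z\<close> that contain both. Nothing is said about the pair \<open>x\<close>, \<open>y\<close> beyond
  \<open>\<not> P y x\<close>; in a signed alphabet the two letters may be equal.
\<close>

lemma chain_sums_swap_last:
  assumes P: "bitransitive P" and yx: "\<not> P y x" and yz: "P y z"
  shows "chain_sums P k (u @ [y, x, z] @ v) = chain_sums P k (u @ [y, z, x] @ v)"
proof (intro equalityI subsetI)
  note D = bitransitiveD[OF P]
  fix n assume "n \<in> chain_sums P k (u @ [y, z, x] @ v)"
  then obtain zs where zs: "map fst zs = u @ [y, z, x] @ v" "chain_colouring P k zs"
      "n = coloured_size k zs"
    by (auto simp: chain_sums_def)
  obtain us vs a b c where e: "zs = us @ [(y, a), (z, b), (x, c)] @ vs" "map fst us = u" "map fst vs = v"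
    using zs(1) by (auto simp: map_eq_append_conv map_eq_Cons_conv)
  \<comment> \<open>No chain contains both \<open>z\<close> and \<open>x\<close>, so the same colours remain admissible.\<close>
  have zx: "\<not> P z x" using yx yz D by blast
  let ?zs = "us @ [(y, a), (x, c), (z, b)] @ vs"
  have "chain_colouring P k ?zs"
    using zs(2) zx unfolding e chain_colouring_def by (auto simp: sorted_wrt_append)
  moreover have "coloured_size k ?zs = n"
    unfolding zs(3) e coloured_size_def by simp
  ultimately show "n \<in> chain_sums P k (u @ [y, x, z] @ v)"
    using e by (force simp: chain_sums_def)
next
  note D = bitransitiveD[OF P]
  fix n assume "n \<in> chain_sums P k (u @ [y, x, z] @ v)"
  then obtain zs where zs: "map fst zs = u @ [y, x, z] @ v" "chain_colouring P k zs"
      "n = coloured_size k zs"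
    by (auto simp: chain_sums_def)
  obtain us vs a b c where e: "zs = us @ [(y, a), (x, b), (z, c)] @ vs" "map fst us = u" "map fst vs = v"
    using zs(1) by (auto simp: map_eq_append_conv map_eq_Cons_conv)
  have sorted: "chain_colouring P k us" "chain_colouring P k vs"
    and uv: "\<And>s t i. (s, i) \<in> set us \<Longrightarrow> (t, i) \<in> set vs \<Longrightarrow> i < k \<Longrightarrow> P s t"
    and uy: "\<And>s. (s, a) \<in> set us \<Longrightarrow> a < k \<Longrightarrow> P s y"
    and ux: "\<And>s. (s, b) \<in> set us \<Longrightarrow> b < k \<Longrightarrow> P s x"
    and uz: "\<And>s. (s, c) \<in> set us \<Longrightarrow> c < k \<Longrightarrow> P s z"
    and yv: "\<And>t. (t, a) \<in> set vs \<Longrightarrow> a < k \<Longrightarrow> P y t"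
    and zv: "\<And>t. (t, c) \<in> set vs \<Longrightarrow> c < k \<Longrightarrow> P z t"
    and ab: "a = b \<Longrightarrow> \<not> a < k"
    using zs(2) yx unfolding e chain_colouring_def sorted_wrt_append by auto
  have "\<exists>zs'. map fst zs' = u @ [y, z, x] @ v \<and> chain_colouring P k zs' \<and> coloured_size k zs' = n"
  proof (cases "b = c \<and> c < k")
    case False
    have "chain_colouring P k (us @ [(y, a), (z, c), (x, b)] @ vs)"
      using zs(2) False unfolding e chain_colouring_def by (auto simp: sorted_wrt_append)
    then show ?thesis
      using e zs(3)
      by (intro exI[of _ "us @ [(y, a), (z, c), (x, b)] @ vs"]) (auto simp: coloured_size_def)
  next
    case True
    then have bc: "b = c" "c < k" by auto
    have yv': "P y t" if "(t, c) \<in> set vs" for t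
      using zv[OF that bc(2)] yz D(1) by blast
    show ?thesis
    proof (cases "a < k")
      case False
      \<comment> \<open>The letter \<open>y\<close> is unused and takes the place of \<open>x\<close>, which becomes unused.\<close>
      have "P s y" if "(s, c) \<in> set us" for s
        using ux[of s] that bc yx D(2)[of s x y] by blast
      then have "chain_colouring P k (us @ [(y, c), (z, c), (x, k)] @ vs)"
        using sorted uv uz zv yv' bc yz
        unfolding chain_colouring_def by (auto simp: sorted_wrt_append)
      then show ?thesis
        using e zs(3) bc False
        by (intro exI[of _ "us @ [(y, c), (z, c), (x, k)] @ vs"]) (auto simp: coloured_size_def)
    next
      case True
      \<comment> \<open>The chain of \<open>y\<close> continues with \<open>z\<close> and its tail, the chain of \<open>x\<close> continues with the
        former tail of \<open>y\<close>: the two colours are exchanged in the letters of \<open>v\<close>.\<close>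
      let ?s = "\<lambda>i. if i = a then c else if i = c then a else i"
      define ts where "ts = map (\<lambda>(t, i). (t, ?s i)) vs"
      have ac: "a \<noteq> c" using ab bc by auto
      have size: "coloured_size k ts = coloured_size k vs"
        unfolding ts_def using True bc by (induction vs) (auto simp: coloured_size_def split: if_splits)
      have v: "map fst ts = v" using e by (auto simp: ts_def)
      have vs': "chain_colouring P k ts"
        using sorted(2) True bc unfolding chain_colouring_iff
        by (auto simp: ts_def case_prod_beta split: if_splits)
      have xv': "P x t" if "(t, a) \<in> set vs" for t
        using yv[OF that True] yx D(2)[of y t x] by blast
      have uz': "P s z" if "(s, a) \<in> set us" for s
        using uy[OF that True] yz D(1) by blast
      have ts: "i = a \<and> (t, c) \<in> set vs \<or> i = c \<and> (t, a) \<in> set vs \<or>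
          i \<noteq> a \<and> i \<noteq> c \<and> (t, i) \<in> set vs" if "(t, i) \<in> set ts" for t i
        using that ac by (auto simp: ts_def split: if_splits)
      have uv': "P s t" if s: "(s, i) \<in> set us" and t: "(t, i) \<in> set ts" and i: "i < k" for s t i
      proof -
        consider "i = a" "(t, c) \<in> set vs" | "i = c" "(t, a) \<in> set vs" | "(t, i) \<in> set vs"
          using ts[OF t] by blast
        then show ?thesis
        proof cases
          case 1
          then show ?thesis using uy[of s] yv' s i D(1) by blast
        next
          case 2
          then show ?thesis using ux[of s] xv' s i bc D(1) by blast
        next
          case 3
          then show ?thesis using uv s i by blast
        qed
      qed
      have "chain_colouring P k (us @ [(y, a), (z, a), (x, c)] @ ts)"
        unfolding chain_colouring_def sorted_wrt_append
      proof (intro conjI ballI)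
        show "sorted_wrt (\<lambda>(a, i) (b, j). i = j \<and> i < k \<longrightarrow> P a b) us"
          "sorted_wrt (\<lambda>(a, i) (b, j). i = j \<and> i < k \<longrightarrow> P a b) ts"
          "sorted_wrt (\<lambda>(a, i) (b, j). i = j \<and> i < k \<longrightarrow> P a b) [(y, a), (z, a), (x, c)]"
          using sorted(1) vs' ac yz by (simp_all add: chain_colouring_def)
      next
        fix p q assume "p \<in> set [(y, a), (z, a), (x, c)]" "q \<in> set ts"
        then show "(case p of (a, i) \<Rightarrow> \<lambda>(b, j). i = j \<and> i < k \<longrightarrow> P a b) q"
          using ts yv' zv xv' bc ac by (cases q) fastforce
      next
        fix p q assume "p \<in> set us" "q \<in> set ([(y, a), (z, a), (x, c)] @ ts)"
        then show "(case p of (a, i) \<Rightarrow> \<lambda>(b, j). i = j \<and> i < k \<longrightarrow> P a b) q"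
          using uy uz' ux uv'[of "fst p" "snd p" "fst q"] bc by (cases p; cases q) auto
      qed
      then show ?thesis
        using e zs(3) bc True size v
        by (intro exI[of _ "us @ [(y, a), (z, a), (x, c)] @ ts"])
          (auto simp: coloured_size_def)
    qed
  qed
  then show "n \<in> chain_sums P k (u @ [y, z, x] @ v)" by (auto simp: chain_sums_def)
qed

text \<open>
  The Knuth relations, oriented as they are used for row insertion. For the relation
  \<open>P\<close> of a signed alphabet, the hypotheses mean \<open>x \<le> y \<le> z\<close>, where equalities are subject to the usual conditions
  on the sign.
\<close>

inductive knuth_step :: "('a \<Rightarrow> 'a \<Rightarrow> bool) \<Rightarrow> 'a list \<Rightarrow> 'a list \<Rightarrow> bool" for P where
  last: "\<not> P y x \<Longrightarrow> P y z \<Longrightarrow> knuth_step P (u @ [y, z, x] @ v) (u @ [y, x, z] @ v)"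
| first: "P x y \<Longrightarrow> \<not> P z y \<Longrightarrow> knuth_step P (u @ [x, z, y] @ v) (u @ [z, x, y] @ v)"

text \<open>Negating \<open>P\<close> exchanges the roles of \<open>x\<close> and \<open>z\<close> and reverses the step.\<close>

lemma knuth_step_not:
  assumes "knuth_step P w w'"
  shows "knuth_step (\<lambda>a b. \<not> P a b) w' w"
  using assms
proof cases
  case (last y x z u v)
  then show ?thesis using knuth_step.last[of "\<lambda>a b. \<not> P a b" y z x u v] by simp
next
  case (first x y z u v)
  then show ?thesis using knuth_step.first[of "\<lambda>a b. \<not> P a b" z y x u v] by simp
qed

text \<open>The second Knuth relation is the mirror image of the first one.\<close>

lemma chain_sums_knuth_step:
  assumes "bitransitive P" "knuth_step P w w'"
  shows "chain_sums P k w = chain_sums P k w'"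
  using assms(2)
proof cases
  case (last y x z u v)
  then show ?thesis using chain_sums_swap_last[OF assms(1) last(3,4), of k u v] by simp
next
  case (first x y z u v)
  have "chain_sums (\<lambda>a b. P b a) k (rev v @ [y, z, x] @ rev u) =
        chain_sums (\<lambda>a b. P b a) k (rev v @ [y, x, z] @ rev u)"
    using first by (intro chain_sums_swap_last[OF bitransitive_conversep[OF assms(1)]])
  then have "chain_sums (\<lambda>a b. P b a) k (rev w) = chain_sums (\<lambda>a b. P b a) k (rev w')"
    by (simp add: first(1,2))
  then show ?thesis by (simp only: chain_sums_rev)
qed

lemma chain_sums_knuth_steps:
  assumes "bitransitive P" "(knuth_step P)\<^sup>*\<^sup>* w w'"
  shows "chain_sums P k w = chain_sums P k w'"
    and "chain_sums (\<lambda>a b. \<not> P a b) k w = chain_sums (\<lambda>a b. \<not> P a b) k w'"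
proof -
  show "chain_sums P k w = chain_sums P k w'"
    using assms(2)
  proof induction
    case (step v v')
    then show ?case using chain_sums_knuth_step[OF assms(1) step(2)] by metis
  qed simp
  show "chain_sums (\<lambda>a b. \<not> P a b) k w = chain_sums (\<lambda>a b. \<not> P a b) k w'"
    using assms(2)
  proof induction
    case (step v v')
    then show ?case
      using chain_sums_knuth_step[OF bitransitive_not[OF assms(1)] knuth_step_not[OF step(2)]]
      by metis
  qed simp
qed

lemma knuth_steps_context:
  assumes "(knuth_step P)\<^sup>*\<^sup>* w w'"
  shows "(knuth_step P)\<^sup>*\<^sup>* (s @ w @ t) (s @ w' @ t)"
  using assms
proof induction
  case (step a b)
  from step(2) have "knuth_step P (s @ a @ t) (s @ b @ t)"
  proof cases
    case (last y x z u v)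
    then show ?thesis using knuth_step.last[of P y x z "s @ u" "v @ t"] by simp
  next
    case (first x y z u v)
    then show ?thesis using knuth_step.first[of P x y z "s @ u" "v @ t"] by simp
  qed
  with step(3) show ?case by simp
qed simp

section \<open>Row insertion\<close>

lemma knuth_steps_move_right_letter:
  assumes P: "bitransitive P" and "sorted_wrt P (y # m)" "\<not> P y x"
  shows "(knuth_step P)\<^sup>*\<^sup>* (y # m @ [x]) (y # x # m)"
  using assms(2,3)
proof (induction m arbitrary: y)
  case (Cons z m)
  have zx: "\<not> P z x" using Cons.prems bitransitiveD(1)[OF P, of y z x] by auto
  have "(knuth_step P)\<^sup>*\<^sup>* ([y] @ (z # m @ [x]) @ []) ([y] @ (z # x # m) @ [])"
    using Cons.IH[of z] Cons.prems zx by (intro knuth_steps_context) auto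
  moreover have "knuth_step P (y # z # x # m) (y # x # z # m)"
    using knuth_step.last[of P y x z "[]" m] Cons.prems by simp
  ultimately show ?case by simp
qed simp

lemma knuth_steps_move_left_letter:
  assumes P: "bitransitive P" and "sorted_wrt P (l @ [x])" "\<not> P y x"
  shows "(knuth_step P)\<^sup>*\<^sup>* (l @ [y, x]) (y # l @ [x])"
  using assms(2,3)
proof (induction l arbitrary: x rule: rev_induct)
  case (snoc z l)
  have yz: "\<not> P y z" and zx: "P z x" and s: "sorted_wrt P (l @ [z])"
    using snoc.prems bitransitiveD(1)[OF P, of y z x] by (auto simp: sorted_wrt_append)
  have "knuth_step P (l @ [z, y, x]) (l @ [y, z, x])"
    using knuth_step.first[of P z x y l "[]"] zx snoc.prems by simp
  moreover have "(knuth_step P)\<^sup>*\<^sup>* ([] @ (l @ [y, z]) @ [x]) ([] @ (y # l @ [z]) @ [x])"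
    using snoc.IH[OF s yz] by (intro knuth_steps_context)
  ultimately show ?case by (simp add: converse_rtranclp_into_rtranclp)
qed simp

text \<open>
  If \<open>x\<close> bumps \<open>y\<close> out of the row \<open>l y m\<close>, then \<open>x\<close> first travels to the left until it stands
  right after \<open>y\<close>, and \<open>y\<close> then travels to the left end.
\<close>

lemma knuth_steps_bump:
  assumes P: "bitransitive P" and r: "sorted_wrt P (l @ y # m)"
    and "\<forall>a\<in>set l. P a x" "\<not> P y x"
  shows "(knuth_step P)\<^sup>*\<^sup>* ((l @ y # m) @ [x]) (y # l @ x # m)"
proof -
  have "(knuth_step P)\<^sup>*\<^sup>* (l @ (y # m @ [x]) @ []) (l @ (y # x # m) @ [])"
    using assms by (intro knuth_steps_context knuth_steps_move_right_letter)
      (auto simp: sorted_wrt_append)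
  moreover have "(knuth_step P)\<^sup>*\<^sup>* ([] @ (l @ [y, x]) @ m) ([] @ (y # l @ [x]) @ m)"
    using assms by (intro knuth_steps_context knuth_steps_move_left_letter)
      (auto simp: sorted_wrt_append)
  ultimately show ?thesis by simp
qed

text \<open>\<open>b\<close> may follow \<open>a\<close> in a row word.\<close>

definition row_le :: "('a::linorder \<Rightarrow> bit) \<Rightarrow> 'a \<Rightarrow> 'a \<Rightarrow> bool" where
  "row_le sg a b \<longleftrightarrow> \<not> bumps sg b a"

lemma bitransitive_row_le: "bitransitive (row_le sg)"
  unfolding bitransitive_def transp_def row_le_def
  by (blast intro: bumps_trans dest: not_bumps_trans)

lemma row_word_iff_sorted: "row_word sg v \<longleftrightarrow> sorted_wrt (row_le sg) v"
  using bitransitive_row_le[of sg]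
  by (simp add: row_word_bumps row_le_def[symmetric] bitransitive_def sorted_wrt_iff_nth_Suc_transp)

lemma column_word_iff_sorted: "column_word sg v \<longleftrightarrow> sorted_wrt (\<lambda>a b. \<not> row_le sg a b) v"
proof -
  have "column_word sg v \<longleftrightarrow> (\<forall>i. Suc i < length v \<longrightarrow> bumps sg (v ! Suc i) (v ! i))"
    by (auto simp: column_word_def bumps_iff)
  then show ?thesis
    using bitransitive_row_le[of sg]
    by (simp add: bitransitive_def sorted_wrt_iff_nth_Suc_transp) (simp add: row_le_def)
qed

text \<open>The reading word of a tableau: its rows from bottom to top, each from left to right.\<close>

definition reading :: "'a list list \<Rightarrow> 'a list" where
  "reading T = concat (rev T)"

lemma tab_rows_tableau_of: "w \<in> lists L \<Longrightarrow> tab_rows L sg (tableau_of sg w)"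
  unfolding tableau_of_def
  by (induction w rule: rev_induct) (auto intro: tab_rows_row_insertion)

lemma knuth_steps_row_insertion:
  "tab_rows L sg T \<Longrightarrow>
    (knuth_step (row_le sg))\<^sup>*\<^sup>* (reading T @ [x]) (reading (row_insertion sg T x))"
proof (induction T arbitrary: x)
  case (Cons r rs)
  show ?case
  proof (cases rule: insert_row_cases[of sg r x])
    case (bump p)
    let ?y = "r ! p" and ?r' = "r[p := x]"
    have r: "r = take p r @ ?y # drop (Suc p) r" "?r' = take p r @ x # drop (Suc p) r"
      using bump(1) by (simp_all add: id_take_nth_drop[symmetric] upd_conv_take_nth_drop)
    have "(knuth_step (row_le sg))\<^sup>*\<^sup>* (r @ [x]) (?y # ?r')"
    proof (subst (1) r(1), subst r(2), rule knuth_steps_bump[OF bitransitive_row_le])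
      show "sorted_wrt (row_le sg) (take p r @ ?y # drop (Suc p) r)"
        using Cons.prems r(1) by (simp add: row_word_iff_sorted)
      show "\<forall>a\<in>set (take p r). row_le sg a x"
        using bump(4) by (auto simp: in_set_conv_nth row_le_def)
      show "\<not> row_le sg ?y x" using bump(3) by (simp add: row_le_def)
    qed
    from knuth_steps_context[OF this, of "reading rs" "[]"]
    have "(knuth_step (row_le sg))\<^sup>*\<^sup>* (reading rs @ r @ [x]) (reading rs @ ?y # ?r')" by simp
    moreover have "(knuth_step (row_le sg))\<^sup>*\<^sup>* ([] @ (reading rs @ [?y]) @ ?r')
        ([] @ reading (row_insertion sg rs ?y) @ ?r')"
      using Cons by (intro knuth_steps_context) auto
    ultimately show ?thesis using bump(2) by (simp add: reading_def)
  qed (simp add: reading_def)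
qed (simp add: reading_def)

lemma knuth_steps_tableau_of:
  "(knuth_step (row_le sg))\<^sup>*\<^sup>* w (reading (tableau_of sg w))"
proof (induction w rule: rev_induct)
  case Nil
  then show ?case by (simp add: reading_def tableau_of_def)
next
  case (snoc x w)
  from knuth_steps_context[OF snoc, of "[]" "[x]"]
  have "(knuth_step (row_le sg))\<^sup>*\<^sup>* (w @ [x]) (reading (tableau_of sg w) @ [x])" by simp
  also have "(knuth_step (row_le sg))\<^sup>*\<^sup>* \<dots> (reading (tableau_of sg (w @ [x])))"
    using knuth_steps_row_insertion[OF tab_rows_tableau_of[of w UNIV sg]]
    by (simp add: tableau_of_def)
  finally show ?case .
qed

section \<open>Chains in the reading word of a tableau\<close>

text \<open>Young diagrams, possibly infinite, with rows and columns numbered from 0.\<close>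

definition down_closed :: "(nat \<times> nat) set \<Rightarrow> bool" where
  "down_closed D \<longleftrightarrow> (\<forall>i j i' j'. (i, j) \<in> D \<and> i' \<le> i \<and> j' \<le> j \<longrightarrow> (i', j') \<in> D)"

text \<open>
  A word whose letters are labelled bijectively by the cells \<open>(i, j)\<close> of \<open>D\<close>, in such a way that each
  row is a chain for \<open>P\<close> and each column is a chain for the negation of \<open>P\<close>. This notion is
  invariant under transposing \<open>D\<close> and negating \<open>P\<close>, so that rows and columns of a tableau are
  on an equal footing.
\<close>

definition tableau_word :: "('a \<Rightarrow> 'a \<Rightarrow> bool) \<Rightarrow> (nat \<times> nat) set \<Rightarrow> ('a \<times> nat \<times> nat) list \<Rightarrow> bool" where
  "tableau_word P D ts \<longleftrightarrow> distinct (map snd ts) \<and> set (map snd ts) = D \<and>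
     sorted_wrt (\<lambda>(a, i, j) (b, i', j'). (i = i' \<longrightarrow> P a b) \<and> (j = j' \<longrightarrow> \<not> P a b)) ts"

lemma card_initial_segment_Int:
  fixes C :: "nat set"
  assumes "finite C" "\<And>i i'. i \<in> C \<Longrightarrow> i' \<le> i \<Longrightarrow> i' \<in> C"
  shows "card {i \<in> C. i < k} = min k (card C)"
proof -
  have "\<exists>m. C = {..<m}"
  proof (cases "C = {}")
    case False
    have "C = {..<Suc (Max C)}"
      using Max_ge[OF assms(1)] assms(2)[OF Max_in[OF assms(1) False]]
      by (auto simp: less_Suc_eq_le)
    then show ?thesis by blast
  qed blast
  then obtain m where m: "C = {..<m}" by blast
  have "{i \<in> C. i < k} = {..<min k m}" by (auto simp: m)
  then show ?thesis by (simp add: m)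
qed

lemma card_eq_sum_fibres:
  assumes "finite A" "finite B" "f ` A \<subseteq> B"
  shows "card A = (\<Sum>y\<in>B. card {x \<in> A. f x = y})"
  using sum.group[OF assms, of "\<lambda>_. 1::nat"] by simp

text \<open>
  Each column \<open>j\<close> meets every one of the \<open>k\<close> chains at most once, and so contributes at most
  as many letters as it has cells in the first \<open>k\<close> rows.
\<close>

lemma chain_sums_tableau_word_upper:
  assumes ts: "tableau_word P D ts" and D: "down_closed D"
    and n: "n \<in> chain_sums P k (map fst ts)"
  shows "n \<le> card {(i, j) \<in> D. i < k}"
proof -
  obtain zs where zs: "map fst zs = map fst ts" "chain_colouring P k zs" "n = coloured_size k zs"
    using n by (auto simp: chain_sums_def)
  have len: "length zs = length ts" using zs(1) map_eq_imp_length_eq by blast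
  have fst_eq: "fst (zs ! p) = fst (ts ! p)" if "p < length ts" for p
    using arg_cong[OF zs(1), of "\<lambda>l. l ! p"] that len by simp
  have dist: "distinct (map snd ts)" and setD: "D = snd ` set ts" and fin: "finite D"
    using ts by (auto simp: tableau_word_def)
  define col where "col p = snd (snd (ts ! p))" for p
  define c where "c p = snd (zs ! p)" for p
  define S where "S = {p. p < length ts \<and> c p < k}"
  have finS: "finite S" by (simp add: S_def)
  have cellD: "snd (ts ! p) \<in> D" if "p < length ts" for p using that setD by auto
  have inj_cell: "inj_on (\<lambda>p. snd (ts ! p)) {..<length ts}"
    using dist by (auto simp: inj_on_def distinct_conv_nth)
  have column: "card {p \<in> S. col p = j} \<le> card {i. (i, j) \<in> D \<and> i < k}" for j
  proof -
    let ?C = "{i. (i, j) \<in> D}"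
    have "?C \<subseteq> fst ` D" by force
    then have finC: "finite ?C" using fin finite_subset by blast
    \<comment> \<open>Two letters of one column are related by \<open>\<not> P\<close>, hence do not have the same colour.\<close>
    have "inj_on c {p \<in> S. col p = j}"
    proof (rule linorder_inj_onI')
      fix p q assume pq: "p \<in> {p \<in> S. col p = j}" "q \<in> {p \<in> S. col p = j}" "p < q"
      then have less: "p < q" "q < length ts" and "c p < k" "col p = col q"
        by (auto simp: S_def)
      have "\<forall>q<length ts. \<forall>p<q. col p = col q \<longrightarrow> \<not> P (fst (ts ! p)) (fst (ts ! q))"
        using ts unfolding tableau_word_def sorted_wrt_iff_nth_less col_def case_prod_beta by blast
      then have "\<not> P (fst (ts ! p)) (fst (ts ! q))"
        using less \<open>col p = col q\<close> by blast
      moreover have "c p = c q \<Longrightarrow> P (fst (ts ! p)) (fst (ts ! q))"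
        using zs(2) less \<open>c p < k\<close> fst_eq[of p] fst_eq[of q] unfolding chain_colouring_iff len c_def
        by (metis less_trans)
      ultimately show "c p \<noteq> c q" by blast
    qed
    then have "card {p \<in> S. col p = j} \<le> card {..<k}"
      by (rule card_inj_on_le) (auto simp: S_def)
    moreover have "card {p \<in> S. col p = j} \<le> card ?C"
    proof (rule card_inj_on_le[of "\<lambda>p. fst (snd (ts ! p))"])
      show "inj_on (\<lambda>p. fst (snd (ts ! p))) {p \<in> S. col p = j}"
      proof (rule inj_onI)
        fix p q assume pq: "p \<in> {p \<in> S. col p = j}" "q \<in> {p \<in> S. col p = j}"
          "fst (snd (ts ! p)) = fst (snd (ts ! q))"
        then have "snd (ts ! p) = snd (ts ! q)" by (simp add: col_def prod_eq_iff)
        then show "p = q" using inj_onD[OF inj_cell] pq by (simp add: S_def)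
      qed
      show "(\<lambda>p. fst (snd (ts ! p))) ` {p \<in> S. col p = j} \<subseteq> ?C"
      proof
        fix i assume "i \<in> (\<lambda>p. fst (snd (ts ! p))) ` {p \<in> S. col p = j}"
        then obtain p where "p < length ts" "col p = j" "i = fst (snd (ts ! p))"
          by (auto simp: S_def)
        then show "i \<in> ?C" using cellD[of p] unfolding col_def by (metis mem_Collect_eq prod.collapse)
      qed
    qed (rule finC)
    moreover have "card {i \<in> ?C. i < k} = min k (card ?C)"
    proof (rule card_initial_segment_Int[OF finC])
      fix i i' assume "i \<in> ?C" "i' \<le> i"
      then show "i' \<in> ?C" using D unfolding down_closed_def by blast
    qed
    ultimately show ?thesis by simp
  qed
  have "n = card S"
    by (simp add: zs(3) coloured_size_card S_def c_def len)
  also have "\<dots> = (\<Sum>j\<in>snd ` D. card {p \<in> S. col p = j})"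
    using cellD fin finS by (intro card_eq_sum_fibres) (auto simp: S_def col_def)
  also have "\<dots> \<le> (\<Sum>j\<in>snd ` D. card {i. (i, j) \<in> D \<and> i < k})"
    by (intro sum_mono column)
  also have "\<dots> = (\<Sum>j\<in>snd ` D. card {d \<in> {(i, j) \<in> D. i < k}. snd d = j})"
  proof (rule sum.cong[OF refl])
    fix j
    have "{d \<in> {(i, j) \<in> D. i < k}. snd d = j} = (\<lambda>i. (i, j)) ` {i. (i, j) \<in> D \<and> i < k}" by auto
    then show "card {i. (i, j) \<in> D \<and> i < k} = card {d \<in> {(i, j) \<in> D. i < k}. snd d = j}"
      by (simp add: card_image inj_on_def)
  qed
  also have "\<dots> = card {(i, j) \<in> D. i < k}"
    using fin by (intro card_eq_sum_fibres[symmetric]) (auto intro: finite_subset[OF _ fin])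
  finally show ?thesis .
qed

lemma Max_chain_sums_tableau_word:
  assumes ts: "tableau_word P D ts" and D: "down_closed D"
  shows "Max (chain_sums P k (map fst ts)) = card {(i, j) \<in> D. i < k}"
proof (rule Max_eqI)
  \<comment> \<open>The maximum is attained by the first \<open>k\<close> rows: each letter is coloured by its row.\<close>
  let ?zs = "map (\<lambda>(a, i, j). (a, i)) ts"
  have "chain_colouring P k ?zs"
    using ts by (auto simp: tableau_word_def chain_colouring_def sorted_wrt_map
        elim!: sorted_wrt_mono_rel[rotated])
  moreover have "map fst ?zs = map fst ts" by auto
  moreover have "coloured_size k ?zs = card {(i, j) \<in> D. i < k}"
  proof -
    let ?R = "\<lambda>d. fst (snd d) < k"
    have "coloured_size k ?zs = length (map snd (filter ?R ts))"
      by (simp add: coloured_size_def filter_map comp_def case_prod_beta)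
    also have "\<dots> = card (set (map snd (filter ?R ts)))"
      using ts by (intro distinct_card[symmetric])
        (auto simp: tableau_word_def distinct_map inj_on_def distinct_filter)
    also have "set (map snd (filter ?R ts)) = {(i, j) \<in> D. i < k}"
      using ts unfolding tableau_word_def by (auto 4 3 intro: rev_image_eqI)
    finally show ?thesis .
  qed
  ultimately show "card {(i, j) \<in> D. i < k} \<in> chain_sums P k (map fst ts)"
    unfolding chain_sums_def by (intro CollectI exI[of _ ?zs]) simp
  show up: "\<And>n. n \<in> chain_sums P k (map fst ts) \<Longrightarrow> n \<le> card {(i, j) \<in> D. i < k}"
    using chain_sums_tableau_word_upper[OF assms] .
  show "finite (chain_sums P k (map fst ts))"
    by (rule finite_subset[of _ "{..card {(i, j) \<in> D. i < k}}"]) (auto dest: up)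
qed

lemma tableau_word_transpose:
  assumes "tableau_word P D ts"
  shows "tableau_word (\<lambda>a b. \<not> P a b) (prod.swap ` D) (map (apsnd prod.swap) ts)"
proof -
  have "map snd (map (apsnd prod.swap) ts) = map prod.swap (map snd ts)" by simp
  moreover have "sorted_wrt (\<lambda>(a, i, j) (b, i', j').
      (i = i' \<longrightarrow> \<not> P a b) \<and> (j = j' \<longrightarrow> \<not> \<not> P a b)) (map (apsnd prod.swap) ts)"
    using assms unfolding tableau_word_def sorted_wrt_map
    by (auto elim!: sorted_wrt_mono_rel[rotated])
  ultimately show ?thesis
    using assms unfolding tableau_word_def
    by (simp only: distinct_map[of prod.swap] set_map[of prod.swap]) simp
qed

text \<open>
  The reading word with each letter labelled by its cell; \<open>i\<close> is the index of the first row.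
\<close>

fun labelled_reading :: "nat \<Rightarrow> 'a list list \<Rightarrow> ('a \<times> nat \<times> nat) list" where
  "labelled_reading i [] = []"
| "labelled_reading i (r # rs) =
     labelled_reading (Suc i) rs @ map (\<lambda>j. (r ! j, i, j)) [0..<length r]"

lemma map_fst_labelled_reading: "map fst (labelled_reading i T) = reading T"
  by (induction T arbitrary: i) (auto simp: reading_def comp_def map_nth)

text \<open>The diagram of the shape of \<open>T\<close>, with rows and columns numbered from 0.\<close>

definition cells :: "'a list list \<Rightarrow> (nat \<times> nat) set" where
  "cells T = {(i, j). i < length T \<and> j < length (T ! i)}"

lemma set_labelled_reading:
  "set (labelled_reading m T) = {(T ! i ! j, m + i, j) | i j. i < length T \<and> j < length (T ! i)}"
proof (induction T arbitrary: m)
  case (Cons r rs)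
  show ?case
    unfolding labelled_reading.simps set_append Cons.IH
    by (auto simp: less_Suc_eq_0_disj)
qed simp

lemma col_lt_trans: "col_lt sg r s \<Longrightarrow> col_lt sg s t \<Longrightarrow> col_lt sg r t"
  unfolding col_lt_def by (meson bumps_trans order_trans less_le_trans)

lemma tab_rows_col_lt:
  "tab_rows L sg (r # rs) \<Longrightarrow> s \<in> set rs \<Longrightarrow> col_lt sg r s"
proof (induction rs arbitrary: r)
  case (Cons t rs)
  have rt: "col_lt sg r t" using Cons.prems by simp
  moreover have "col_lt sg t s" if "s \<noteq> t"
    using Cons.IH[of t] Cons.prems that by simp
  ultimately show ?case by (cases "s = t") (auto intro: col_lt_trans)
qed simp

lemma tableau_word_labelled_reading:
  assumes "tab_rows L sg T"
  shows "tableau_word (row_le sg) (cells T) (labelled_reading 0 T)"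
proof -
  have "distinct (map snd (labelled_reading m T))" for m
  proof (induction T arbitrary: m)
    case (Cons r rs)
    have "snd ` set (labelled_reading (Suc m) rs) \<inter> snd ` (\<lambda>j. (r ! j, m, j)) ` {0..<length r} = {}"
      by (auto simp: set_labelled_reading)
    moreover have "distinct (map snd (map (\<lambda>j. (r ! j, m, j)) [0..<length r]))"
      by (simp add: distinct_map inj_on_def)
    ultimately show ?case using Cons.IH[of "Suc m"] by (simp add: image_image)
  qed simp
  moreover have "sorted_wrt (\<lambda>(a, i, j) (b, i', j').
      (i = i' \<longrightarrow> row_le sg a b) \<and> (j = j' \<longrightarrow> \<not> row_le sg a b)) (labelled_reading m T)" for m
    using assms
  proof (induction T arbitrary: m)
    case (Cons r rs)
    have c: "bumps sg (r ! j) (rs ! i ! j)" if "i < length rs" "j < length (rs ! i)" for i j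
      using tab_rows_col_lt[OF Cons.prems, of "rs ! i"] that by (auto simp: col_lt_def)
    let ?R = "\<lambda>(a, i, j) (b, i', j').
      (i = i' \<longrightarrow> row_le sg a b) \<and> ((j::nat) = j' \<longrightarrow> \<not> row_le sg a b)"
    have "sorted_wrt (row_le sg) r" using Cons.prems by (simp add: row_word_iff_sorted)
    then have "sorted_wrt ?R (map (\<lambda>j. (r ! j, m, j)) [0..<length r])"
      by (simp add: sorted_wrt_iff_nth_less)
    moreover have "sorted_wrt ?R (labelled_reading (Suc m) rs)"
      using Cons.IH Cons.prems by simp
    ultimately show ?case
      using c by (auto simp: sorted_wrt_append set_labelled_reading row_le_def)
  qed simp
  moreover have "set (map snd (labelled_reading 0 T)) = cells T"
    by (auto simp: set_labelled_reading cells_def image_iff)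
  ultimately show ?thesis by (simp add: tableau_word_def)
qed

lemma down_closed_cells:
  assumes "tab_rows L sg T"
  shows "down_closed (cells T)"
proof -
  have "length (T ! i) \<le> length (T ! i')" if "i' \<le> i" "i < length T" for i i'
    using tab_rows_sorted[OF assms] that
    by (cases "i' = i") (auto simp: sorted_wrt_iff_nth_less)
  then show ?thesis by (fastforce simp: down_closed_def cells_def)
qed

section \<open>Row and column lengths of the shape\<close>

lemma card_cells_rows:
  "card {(i, j) \<in> cells T. i < k} = (\<Sum>i=1..k. part (shape T) i)"
proof -
  have "{(i, j) \<in> cells T. i < k} = (SIGMA i:{..<k}. {..<part (shape T) (Suc i)})"
    by (auto simp: cells_def part_def shape_def split: if_splits)
  then have "card {(i, j) \<in> cells T. i < k} = (\<Sum>i<k. part (shape T) (Suc i))" by simp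
  then show ?thesis by (simp add: sum.atLeast1_atMost_eq)
qed

lemma part_conjugate:
  assumes "tab_rows L sg T"
  shows "part (conjugate (shape T)) (Suc j) = card {i. (i, j) \<in> cells T}"
proof -
  have eq: "{i. (i, Suc j) \<in> diagram (shape T)} = Suc ` {i. (i, j) \<in> cells T}"
    by (auto simp: diagram_def cells_def part_def shape_def image_iff Suc_le_eq gr0_conv_Suc)
  show ?thesis
  proof (cases "j < part (shape T) 1")
    case True
    then have "part (conjugate (shape T)) (Suc j) = card {i. (i, Suc j) \<in> diagram (shape T)}"
      unfolding conjugate_def part_def[of "map _ _"] by (simp del: upt_Suc)
    then show ?thesis by (simp add: eq card_image)
  next
    case False
    \<comment> \<open>Beyond the last column the part is 0 by convention, and the column is empty.\<close>
    have "(0, j) \<in> cells T" if "(i, j) \<in> cells T" for i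
      using down_closed_cells[OF assms] that unfolding down_closed_def by blast
    then have "{i. (i, j) \<in> cells T} = {}"
      using False by (fastforce simp: cells_def part_def shape_def)
    then show ?thesis using False
      unfolding conjugate_def part_def[of "map _ _"] by (simp del: upt_Suc)
  qed
qed

lemma card_cells_columns:
  assumes "tab_rows L sg T"
  shows "card {(j, i) \<in> prod.swap ` cells T. j < k} = (\<Sum>j=1..k. part (conjugate (shape T)) j)"
proof -
  have "finite {i. (i, j) \<in> cells T}" for j
    by (rule finite_subset[of _ "{..<length T}"]) (auto simp: cells_def)
  moreover have "{(j, i) \<in> prod.swap ` cells T. j < k} = (SIGMA j:{..<k}. {i. (i, j) \<in> cells T})"
    by auto
  ultimately have "card {(j, i) \<in> prod.swap ` cells T. j < k} = (\<Sum>j<k. card {i. (i, j) \<in> cells T})"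
    by simp
  then show ?thesis by (simp add: sum.atLeast1_atMost_eq part_conjugate[OF assms])
qed

theorem theorem3p10:
  fixes L :: "'a::linorder set" and sg :: "'a \<Rightarrow> bit" and w :: "'a list" and k :: nat
  assumes "countable L"
    and "w \<in> lists L"
    and "k \<ge> 1"
  shows "max_row_length sg k w = (\<Sum>i=1..k. part (shape (tableau_of sg w)) i) \<and>
    max_column_length sg k w = (\<Sum>j=1..k. part (conjugate (shape (tableau_of sg w))) j)"
proof -
  let ?T = "tableau_of sg w" and ?P = "row_le sg"
  let ?ts = "labelled_reading 0 ?T"
  let ?ts' = "map (apsnd prod.swap) ?ts"
  have T: "tab_rows L sg ?T" using assms(2) by (rule tab_rows_tableau_of)
  note word = tableau_word_labelled_reading[OF T] and down = down_closed_cells[OF T]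
  note steps = chain_sums_knuth_steps[OF bitransitive_row_le knuth_steps_tableau_of]
  have "max_row_length sg k w = Max (chain_sums ?P k w)"
    unfolding max_row_length_def extraction_sums_eq_chain_sums[OF row_word_iff_sorted] ..
  also have "chain_sums ?P k w = chain_sums ?P k (map fst ?ts)"
    by (simp add: map_fst_labelled_reading steps(1)[of _ _ w])
  also have "Max \<dots> = (\<Sum>i=1..k. part (shape ?T) i)"
    by (simp only: Max_chain_sums_tableau_word[OF word down] card_cells_rows)
  finally have rows: "max_row_length sg k w = (\<Sum>i=1..k. part (shape ?T) i)" .
  have "max_column_length sg k w = Max (chain_sums (\<lambda>a b. \<not> ?P a b) k w)"
    unfolding max_column_length_def extraction_sums_eq_chain_sums[OF column_word_iff_sorted] ..
  also have "chain_sums (\<lambda>a b. \<not> ?P a b) k w = chain_sums (\<lambda>a b. \<not> ?P a b) k (map fst ?ts')"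
    by (simp add: map_fst_labelled_reading steps(2)[of _ _ w])
  also have "Max \<dots> = (\<Sum>j=1..k. part (conjugate (shape ?T)) j)"
  proof -
    have "down_closed (prod.swap ` cells ?T)"
      using down by (fastforce simp: down_closed_def)
    from Max_chain_sums_tableau_word[OF tableau_word_transpose[OF word] this]
    show ?thesis by (simp only: card_cells_columns[OF T])
  qed
  finally show ?thesis using rows by simp
qed

end
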